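(* Let $F$ be a right $E$-Ehresmann monoid and let $M$ be a monoid subsemigroup of $F$ such that: (1) there exists a unary operation $t\mapsto t^+$ on $F$ with $t^+\in E$ for all $t \in F$, such that whenever $t,x\in M$ and $e=tx$ satisfies $e=e^2\in E$, then $e=t^+x^*$; (2) whenever $t,x,y,w\in M$ satisfy $tx\in E$ and $xw=yw$, then $ty\in E$; (3) there exist elements $a,b\in M$ such that (i) the elements $b,ba,ba^2,\ldots$ are pairwise incomparable under the preorder $\leq_{\widetilde{\mathcal L}_E}$ of $F$; (ii) for each $i\ge 0$ we have $M\cap(E_{i+1}\setminus E_i)\neq\emptyset$, where $E_i:=\{f\in E: fba^i=ba^i\}$; (iii) for each $i\ge 0$ and all $x,y\in M$, if $xba^i=yba^i$ and $x^*ba^i=ba^i$, then $y^*ba^i=ba^i$. Then $M$ is not left coherent.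
   Context: Let $S$ be a monoid and $E$ a set of idempotents of $S$. Define a preorder on $S$ by $a\leq_{\widetilde{\mathcal L}_E} b$ if and only if $\{e\in E: be=b\}\subseteq\{e\in E: ae=a\}$, and let $\widetilde{\mathcal L}_E$ be the associated equivalence relation (so $a\,\widetilde{\mathcal L}_E\,b$ iff $a$ and $b$ have the same right identities in $E$). $S$ is right $E$-Ehresmann if $E$ is a semilattice (a commutative subsemigroup of idempotents), every $\widetilde{\mathcal L}_E$-class of $S$ contains exactly one element of $E$, and $\widetilde{\mathcal L}_E$ is a right congruence; $a^*$ denotes the unique element of $E$ in the $\widetilde{\mathcal L}_E$-class of $a$. A monoid subsemigroup of $F$ is a subsemigroup of $F$ that is itself a monoid (its identity need not be that of $F$). By convention $ba^0=b$. A left $S$-act is a set with a unital associative left action of the monoid $S$. It is finitely presented if it is isomorphic to a quotient of a free left $S$-act on a finite set by a finitely generated left $S$-act congruence. A monoid $S$ is left coherent if every finitely generated subact of every finitely presented left $S$-act is finitely presented. *)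

theory Defs
  imports "HOL-Algebra.Group"
begin

section \<open>Acts and coherency\<close>

locale left_act = monoid S
  for S (structure) and A :: "'b set" and act :: "'a \<Rightarrow> 'b \<Rightarrow> 'b" +
  assumes act_closed: "\<lbrakk>s \<in> carrier S; x \<in> A\<rbrakk> \<Longrightarrow> act s x \<in> A"
    and act_one: "x \<in> A \<Longrightarrow> act \<one> x = x"
    and act_mult: "\<lbrakk>s \<in> carrier S; t \<in> carrier S; x \<in> A\<rbrakk>
                     \<Longrightarrow> act (s \<otimes> t) x = act s (act t x)"

definition isomorphic_acts ::
    "('a, 'm) monoid_scheme \<Rightarrow> 'b set \<Rightarrow> ('a \<Rightarrow> 'b \<Rightarrow> 'b) \<Rightarrow> 'c set \<Rightarrow> ('a \<Rightarrow> 'c \<Rightarrow> 'c) \<Rightarrow> bool"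
  where "isomorphic_acts S A actA B actB \<longleftrightarrow>
    (\<exists>f. bij_betw f A B \<and> (\<forall>s\<in>carrier S. \<forall>x\<in>A. f (actA s x) = actB s (f x)))"

definition act_congruence ::
    "('a, 'm) monoid_scheme \<Rightarrow> 'b set \<Rightarrow> ('a \<Rightarrow> 'b \<Rightarrow> 'b) \<Rightarrow> 'b rel \<Rightarrow> bool"
  where "act_congruence S A act \<rho> \<longleftrightarrow>
    equiv A \<rho> \<and> (\<forall>s\<in>carrier S. \<forall>(x, y)\<in>\<rho>. (act s x, act s y) \<in> \<rho>)"

definition generated_congruence ::
    "('a, 'm) monoid_scheme \<Rightarrow> 'b set \<Rightarrow> ('a \<Rightarrow> 'b \<Rightarrow> 'b) \<Rightarrow> 'b rel \<Rightarrow> 'b rel"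
  where "generated_congruence S A act H = \<Inter>{\<rho>. act_congruence S A act \<rho> \<and> H \<subseteq> \<rho>}"

definition finitely_generated_congruence ::
    "('a, 'm) monoid_scheme \<Rightarrow> 'b set \<Rightarrow> ('a \<Rightarrow> 'b \<Rightarrow> 'b) \<Rightarrow> 'b rel \<Rightarrow> bool"
  where "finitely_generated_congruence S A act \<rho> \<longleftrightarrow>
    (\<exists>H. finite H \<and> H \<subseteq> A \<times> A \<and> \<rho> = generated_congruence S A act H)"

text \<open>The induced action on \<^term>\<open>A // \<rho>\<close>. For a congruence, the \<open>\<rho>\<close>-saturation of the
  translate \<open>s C\<close> of a class \<open>C\<close> is again a single class.\<close>

definition quotient_act :: "('a \<Rightarrow> 'b \<Rightarrow> 'b) \<Rightarrow> 'b rel \<Rightarrow> 'a \<Rightarrow> 'b set \<Rightarrow> 'b set"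
  where "quotient_act act \<rho> s C = \<rho> `` (act s ` C)"

definition free_act_carrier :: "'x set \<Rightarrow> ('a, 'm) monoid_scheme \<Rightarrow> ('x \<times> 'a) set"
  where "free_act_carrier X S = X \<times> carrier S"

definition free_act :: "('a, 'm) monoid_scheme \<Rightarrow> 'a \<Rightarrow> 'x \<times> 'a \<Rightarrow> 'x \<times> 'a"
  where "free_act S s p = (fst p, s \<otimes>\<^bsub>S\<^esub> snd p)"

text \<open>Every finite set is in bijection with a set of natural numbers, so it suffices to take
  finite bases \<open>X\<close> in \<^typ>\<open>nat\<close>.\<close>

definition finitely_presented_act ::
    "('a, 'm) monoid_scheme \<Rightarrow> 'b set \<Rightarrow> ('a \<Rightarrow> 'b \<Rightarrow> 'b) \<Rightarrow> bool"
  where "finitely_presented_act S A act \<longleftrightarrow>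
    (\<exists>(X :: nat set) \<rho>. finite X \<and>
       finitely_generated_congruence S (free_act_carrier X S) (free_act S) \<rho> \<and>
       isomorphic_acts S (free_act_carrier X S // \<rho>) (quotient_act (free_act S) \<rho>) A act)"

definition finitely_generated_subact ::
    "('a, 'm) monoid_scheme \<Rightarrow> 'b set \<Rightarrow> ('a \<Rightarrow> 'b \<Rightarrow> 'b) \<Rightarrow> 'b set \<Rightarrow> bool"
  where "finitely_generated_subact S A act B \<longleftrightarrow>
    (\<exists>Y. finite Y \<and> Y \<subseteq> A \<and> B = {act s y | s y. s \<in> carrier S \<and> y \<in> Y})"

text \<open>A definition cannot quantify over all types. The acts below live in
  \<^typ>\<open>(nat \<times> 'a) set\<close>, the type of the quotients of the free acts above, so every
  finitely presented act has an isomorphic copy there; \<open>left_coherentD\<close> shows that the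
  property then holds for acts on any type.\<close>

definition left_coherent :: "('a, 'm) monoid_scheme \<Rightarrow> bool"
  where "left_coherent S \<longleftrightarrow>
    (\<forall>(A :: (nat \<times> 'a) set set) act B.
       left_act S A act \<longrightarrow> finitely_presented_act S A act \<longrightarrow>
       finitely_generated_subact S A act B \<longrightarrow> finitely_presented_act S B act)"

lemma isomorphic_acts_trans:
  assumes "isomorphic_acts S A actA B actB" "isomorphic_acts S B actB C actC"
  shows "isomorphic_acts S A actA C actC"
proof -
  obtain f g where f: "bij_betw f A B" "\<forall>s\<in>carrier S. \<forall>x\<in>A. f (actA s x) = actB s (f x)"
    and g: "bij_betw g B C" "\<forall>s\<in>carrier S. \<forall>x\<in>B. g (actB s x) = actC s (g x)"
    using assms unfolding isomorphic_acts_def by blast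
  have "bij_betw (g \<circ> f) A C" using f g by (blast intro: bij_betw_trans)
  moreover have "\<forall>s\<in>carrier S. \<forall>x\<in>A. (g \<circ> f) (actA s x) = actC s ((g \<circ> f) x)"
    using f g by (auto dest: bij_betwE)
  ultimately show ?thesis unfolding isomorphic_acts_def by blast
qed

lemma left_coherentD:
  fixes S :: "('a, 'm) monoid_scheme" and A :: "'b set"
  assumes coh: "left_coherent S" and A: "left_act S A act"
    and fp: "finitely_presented_act S A act" and fg: "finitely_generated_subact S A act B"
  shows "finitely_presented_act S B act"
proof -
  interpret left_act S A act by (fact A)
  obtain X :: "nat set" and \<rho> where X: "finite X"
      "finitely_generated_congruence S (free_act_carrier X S) (free_act S) \<rho>"
      "isomorphic_acts S (free_act_carrier X S // \<rho>) (quotient_act (free_act S) \<rho>) A act"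
    using fp unfolding finitely_presented_act_def by blast
  let ?Q = "free_act_carrier X S // \<rho>"
  let ?q = "quotient_act (free_act S) \<rho>"
  obtain f where f: "bij_betw f ?Q A" "\<forall>s\<in>carrier S. \<forall>x\<in>?Q. f (?q s x) = act s (f x)"
    using X(3) unfolding isomorphic_acts_def by blast
  define g where "g = inv_into ?Q f"
  have g: "bij_betw g A ?Q" unfolding g_def using f(1) by (rule bij_betw_inv_into)
  have fg_id: "f (g x) = x" if "x \<in> A" for x
    unfolding g_def using f(1) that by (simp add: bij_betw_inv_into_right)
  have gf_id: "g (f x) = x" if "x \<in> ?Q" for x
    unfolding g_def using f(1) that by (simp add: bij_betw_inv_into_left)
  have gA: "g x \<in> ?Q" if "x \<in> A" for x using g that by (blast dest: bij_betwE)
  define q where "q s C = g (act s (f C))" for s C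
  have fQ: "f x \<in> A" if "x \<in> ?Q" for x using f(1) that by (blast dest: bij_betwE)
  have Q: "left_act S ?Q q"
    by unfold_locales
      (auto simp: q_def fQ gf_id fg_id gA act_closed act_one act_mult)
  have "\<forall>s\<in>carrier S. \<forall>x\<in>A. g (act s x) = q s (g x)"
    by (simp add: q_def fg_id)
  then have "isomorphic_acts S A act ?Q q"
    unfolding isomorphic_acts_def using g by blast
  with X(3) have "isomorphic_acts S ?Q ?q ?Q q" by (rule isomorphic_acts_trans)
  then have fpQ: "finitely_presented_act S ?Q q"
    unfolding finitely_presented_act_def using X(1,2) by blast
  obtain Y where Y: "finite Y" "Y \<subseteq> A" "B = {act s y | s y. s \<in> carrier S \<and> y \<in> Y}"
    using fg unfolding finitely_generated_subact_def by blast
  have BA: "B \<subseteq> A" using Y act_closed by auto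
  have "g ` B = {q s y | s y. s \<in> carrier S \<and> y \<in> g ` Y}"
    unfolding Y(3) q_def
  proof safe
    fix s y assume "s \<in> carrier S" "y \<in> Y"
    then show "\<exists>s' y'. g (act s y) = g (act s' (f y')) \<and> s' \<in> carrier S \<and> y' \<in> g ` Y"
      using Y(2) fg_id[of y] by (intro exI[of _ s] exI[of _ "g y"]) auto
  next
    fix s y assume "s \<in> carrier S" "y \<in> Y"
    then show "g (act s (f (g y))) \<in> g ` {act s y | s y. s \<in> carrier S \<and> y \<in> Y}"
      using Y(2) by (auto simp: fg_id subsetD)
  qed
  then have "finitely_generated_subact S ?Q q (g ` B)"
    unfolding finitely_generated_subact_def using Y(1,2) gA
    by (intro exI[of _ "g ` Y"]) auto
  then have fpB: "finitely_presented_act S (g ` B) q"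
    using coh Q fpQ unfolding left_coherent_def by blast
  have "bij_betw f (g ` B) B"
    using BA fg_id by (intro bij_betwI[of _ _ _ g]) auto
  moreover have "\<forall>s\<in>carrier S. \<forall>x\<in>g ` B. f (q s x) = act s (f x)"
    using BA by (auto simp: q_def fg_id act_closed subsetD)
  ultimately have iso: "isomorphic_acts S (g ` B) q B act"
    unfolding isomorphic_acts_def by blast
  obtain X' :: "nat set" and \<rho>' where X': "finite X'"
      "finitely_generated_congruence S (free_act_carrier X' S) (free_act S) \<rho>'"
      "isomorphic_acts S (free_act_carrier X' S // \<rho>') (quotient_act (free_act S) \<rho>') (g ` B) q"
    using fpB unfolding finitely_presented_act_def by blast
  have "isomorphic_acts S (free_act_carrier X' S // \<rho>') (quotient_act (free_act S) \<rho>') B act"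
    using X'(3) iso by (rule isomorphic_acts_trans)
  then show ?thesis
    unfolding finitely_presented_act_def using X'(1,2) by blast
qed

section \<open>Right Ehresmann monoids\<close>

definition L_le :: "('a, 'm) monoid_scheme \<Rightarrow> 'a set \<Rightarrow> 'a \<Rightarrow> 'a \<Rightarrow> bool"
  where "L_le S E a b \<longleftrightarrow> {e \<in> E. b \<otimes>\<^bsub>S\<^esub> e = b} \<subseteq> {e \<in> E. a \<otimes>\<^bsub>S\<^esub> e = a}"

definition L_eq :: "('a, 'm) monoid_scheme \<Rightarrow> 'a set \<Rightarrow> 'a \<Rightarrow> 'a \<Rightarrow> bool"
  where "L_eq S E a b \<longleftrightarrow> L_le S E a b \<and> L_le S E b a"

locale right_Ehresmann_monoid = monoid S for S (structure) +
  fixes E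
  assumes E_subset: "E \<subseteq> carrier S"
    and E_idem: "e \<in> E \<Longrightarrow> e \<otimes> e = e"
    and E_closed: "\<lbrakk>e \<in> E; f \<in> E\<rbrakk> \<Longrightarrow> e \<otimes> f \<in> E"
    and E_comm: "\<lbrakk>e \<in> E; f \<in> E\<rbrakk> \<Longrightarrow> e \<otimes> f = f \<otimes> e"
    and ex1_E_class: "a \<in> carrier S \<Longrightarrow> \<exists>!e. e \<in> E \<and> L_eq S E e a"
    and L_right_congruence:
      "\<lbrakk>a \<in> carrier S; b \<in> carrier S; c \<in> carrier S; L_eq S E a b\<rbrakk>
         \<Longrightarrow> L_eq S E (a \<otimes> c) (b \<otimes> c)"

definition E_star :: "('a, 'm) monoid_scheme \<Rightarrow> 'a set \<Rightarrow> 'a \<Rightarrow> 'a"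
  where "E_star S E a = (THE e. e \<in> E \<and> L_eq S E e a)"

definition left_identities :: "('a, 'm) monoid_scheme \<Rightarrow> 'a set \<Rightarrow> 'a \<Rightarrow> 'a set"
  where "left_identities S E x = {f \<in> E. f \<otimes>\<^bsub>S\<^esub> x = x}"

text \<open>\<open>M\<close> is a monoid under the multiplication of \<open>F\<close>, with its own identity \<open>u\<close>.\<close>

definition monoid_subsemigroup :: "('a, 'm) monoid_scheme \<Rightarrow> 'a set \<Rightarrow> 'a \<Rightarrow> bool"
  where "monoid_subsemigroup F M u \<longleftrightarrow>
    M \<subseteq> carrier F \<and> monoid (F\<lparr>carrier := M, one := u\<rparr>)"

end

theory Submission
  imports Defs Complex_Main
begin

text \<open>
  The argument takes place inside \<open>M\<close> and rests on two facts about left multiples of the elements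
  \<open>b a\<^sup>i\<close>:

  \<^item> \<open>b a\<^sup>i\<close> is a left multiple of \<open>b a\<^sup>j\<close> only for \<open>i = j\<close>. Every right identity of an element is a
    right identity of all its left multiples, so another left multiple would contradict
    incomparability.

  \<^item> For each \<open>i\<close> some element of \<open>M\<close> fixes \<open>b a\<^bsup>i+1\<^esup>\<close> but not \<open>b a\<^sup>i\<close> on the left, namely any
    element of \<open>M\<close> in \<open>E\<^bsub>i+1\<^esub> - E\<^bsub>i\<^esub>\<close>.

  Identify \<open>1\<close> with \<open>a\<close> in the free act of rank one. In the resulting finitely presented act,
  \<open>x\<close> and \<open>y\<close> are equal precisely when \<open>x a\<^sup>m = y a\<^sup>n\<close> for some \<open>m\<close> and \<open>n\<close>. The subact generated by
  the class of \<open>b\<close> is cyclic, and the annihilator of this generator consists of the pairs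
  \<open>(s, t)\<close> with \<open>s b a\<^sup>m = t b a\<^sup>n\<close> for some \<open>m\<close> and \<open>n\<close>.

  If this subact were finitely presented, its annihilator would be a finitely generated
  congruence, and finitely many generating pairs involve only exponents up to some bound \<open>N\<close>.
  Suppose that \<open>r s\<close> fixes \<open>b a\<^bsup>N+1\<^esup>\<close>, where \<open>(s, t)\<close> is a generating pair with exponents \<open>m\<close> and
  \<open>n\<close>. Then \<open>b a\<^bsup>N+1\<^esup>\<close> is a left multiple of \<open>b a\<^bsup>N+1-m+n\<^esup>\<close>, so \<open>m = n\<close>, and hence \<open>r s\<close> and \<open>r t\<close>
  agree already on \<open>b a\<^sup>N\<close>. So a chain of generating pairs that starts at an element fixing
  \<open>b a\<^bsup>N+1\<^esup>\<close> cannot change its product with \<open>b a\<^sup>N\<close>. But an element that fixes \<open>b a\<^bsup>N+1\<^esup>\<close> and not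
  \<open>b a\<^sup>N\<close> is related to \<open>1\<close> by the annihilator, a contradiction.

  The invariant that such chains preserve is itself a congruence for each \<open>N\<close>
  (\<open>fixing_congruence\<close>). Every pair of the annihilator lies in it for all large \<open>N\<close>
  (\<open>mem_fixing_congruence\<close>), although for no \<open>N\<close> does it contain the whole annihilator. This
  contradicts finite presentability by \<open>annihilator_compact\<close>, which takes the place of an explicit
  induction along chains and works directly with an arbitrary presentation of the subact.
\<close>

section \<open>Congruences and quotients of acts\<close>

lemma act_congruence_generated:
  assumes closed: "\<And>s x. \<lbrakk>s \<in> carrier S; x \<in> A\<rbrakk> \<Longrightarrow> act s x \<in> A" and H: "H \<subseteq> A \<times> A"
  shows "act_congruence S A act (generated_congruence S A act H)"
proof -
  let ?R = "{\<rho>. act_congruence S A act \<rho> \<and> H \<subseteq> \<rho>}"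
  have "act_congruence S A act (A \<times> A)"
    using closed by (auto simp: act_congruence_def intro!: equivI refl_onI symI transI)
  then have top: "A \<times> A \<in> ?R" using H by simp
  have each: "equiv A \<rho>" if "\<rho> \<in> ?R" for \<rho> using that by (simp add: act_congruence_def)
  have "equiv A (\<Inter>?R)"
  proof (rule equivI)
    show "\<Inter>?R \<subseteq> A \<times> A" using top by blast
    show "refl_on A (\<Inter>?R)" using each by (auto simp: refl_on_def equiv_def)
    show "sym (\<Inter>?R)" using each by (intro symI) (auto simp: equiv_def dest: symD)
    show "trans (\<Inter>?R)" using each unfolding equiv_def trans_def by blast
  qed
  moreover have "(act s x, act s y) \<in> \<Inter>?R" if "s \<in> carrier S" "(x, y) \<in> \<Inter>?R" for s x y
    using that by (fastforce simp: act_congruence_def)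
  ultimately show ?thesis
    by (auto simp: generated_congruence_def act_congruence_def)
qed

lemma generated_congruence_least:
  assumes "act_congruence S A act \<rho>" "H \<subseteq> \<rho>"
  shows "generated_congruence S A act H \<subseteq> \<rho>"
  using assms unfolding generated_congruence_def by blast

lemma generated_congruence_generators: "H \<subseteq> generated_congruence S A act H"
  unfolding generated_congruence_def by blast

lemma quotient_act_class:
  assumes \<rho>: "act_congruence S A act \<rho>" and s: "s \<in> carrier S" and x: "x \<in> A"
  shows "quotient_act act \<rho> s (\<rho> `` {x}) = \<rho> `` {act s x}"
proof -
  have eq: "equiv A \<rho>" and comp: "(act s x, act s y) \<in> \<rho>" if "(x, y) \<in> \<rho>" for y
    using \<rho> s that unfolding act_congruence_def by auto
  have xx: "(x, x) \<in> \<rho>" using \<rho> x unfolding act_congruence_def by (auto elim: equivE dest: refl_onD)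
  have "\<rho> `` {act s y} = \<rho> `` {act s x}" if "(x, y) \<in> \<rho>" for y
    using equiv_class_eq[OF eq[OF that] comp[OF that]] by simp
  then have "(\<Union>y\<in>\<rho> `` {x}. \<rho> `` {act s y}) = \<rho> `` {act s x}"
    using xx by blast
  then show ?thesis unfolding quotient_act_def by blast
qed

lemma (in left_act) left_act_quotient:
  assumes \<rho>: "act_congruence S A act \<rho>"
  shows "left_act S (A // \<rho>) (quotient_act act \<rho>)"
  by unfold_locales
    (auto elim!: quotientE simp: quotient_act_class[OF \<rho>] act_closed act_one act_mult
      intro!: quotientI act_closed)

lemma left_act_free: "monoid S \<Longrightarrow> left_act S (free_act_carrier X S) (free_act S)"
  by (intro left_act.intro left_act_axioms.intro)
    (auto simp: free_act_carrier_def free_act_def monoid.m_closed monoid.l_one monoid.m_assoc)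

section \<open>Annihilators in finitely presented cyclic acts\<close>

text \<open>
  The annihilator of a generator of a finitely presented cyclic act is a compact element among
  the left congruences on the monoid, whichever finite presentation is given: a family of
  congruences that eventually contains each single pair of the annihilator eventually contains
  all of it. The reason is that the annihilator is controlled by finitely many of its pairs: those
  obtained from the generating pairs of the presentation by writing its generators as multiples
  \<open>c x \<beta>\<close>, and one more pair \<open>(d (c x0), 1)\<close>, which records that \<open>\<beta>\<close> is in turn the multiple
  \<open>d x0\<close> of a generator of the presentation.
\<close>

lemma (in left_act) annihilator_compact:
  fixes K :: "'i \<Rightarrow> 'a rel"
  assumes \<beta>: "\<beta> \<in> A" and B: "B = {act s \<beta> | s. s \<in> carrier S}"
    and fp: "finitely_presented_act S B act"
    and K: "\<And>i. act_congruence S (carrier S) (mult S) (K i)"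
    and ev: "\<And>s t. \<lbrakk>s \<in> carrier S; t \<in> carrier S; act s \<beta> = act t \<beta>\<rbrakk>
               \<Longrightarrow> eventually (\<lambda>i. (s, t) \<in> K i) \<F>"
  shows "eventually (\<lambda>i. \<forall>s\<in>carrier S. \<forall>t\<in>carrier S. act s \<beta> = act t \<beta> \<longrightarrow> (s, t) \<in> K i) \<F>"
proof -
  obtain X :: "nat set" and \<sigma> H f where H: "finite H"
      "H \<subseteq> free_act_carrier X S \<times> free_act_carrier X S"
      "\<sigma> = generated_congruence S (free_act_carrier X S) (free_act S) H"
    and f: "bij_betw f (free_act_carrier X S // \<sigma>) B"
      "\<forall>s\<in>carrier S. \<forall>C\<in>free_act_carrier X S // \<sigma>.
         f (quotient_act (free_act S) \<sigma> s C) = act s (f C)"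
    using fp unfolding finitely_presented_act_def finitely_generated_congruence_def
      isomorphic_acts_def by blast
  interpret free: left_act S "free_act_carrier X S" "free_act S"
    by (rule left_act_free[OF monoid_axioms])
  have \<sigma>: "act_congruence S (free_act_carrier X S) (free_act S) \<sigma>"
    unfolding H(3) using free.act_closed H(2) by (rule act_congruence_generated)
  then have eq\<sigma>: "equiv (free_act_carrier X S) \<sigma>" by (simp add: act_congruence_def)
  have in_free: "(x, s) \<in> free_act_carrier X S" if "x \<in> X" "s \<in> carrier S" for x s
    using that by (simp add: free_act_carrier_def)
  have "\<exists>c. c \<in> carrier S \<and> f (\<sigma> `` {(x, \<one>)}) = act c \<beta>" if "x \<in> X" for x
  proof -
    have "f (\<sigma> `` {(x, \<one>)}) \<in> B"
      using bij_betwE[OF f(1)] in_free[OF that one_closed] by (blast intro: quotientI)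
    then show ?thesis unfolding B by blast
  qed
  then obtain c where c: "\<And>x. x \<in> X \<Longrightarrow> c x \<in> carrier S"
      "\<And>x. x \<in> X \<Longrightarrow> f (\<sigma> `` {(x, \<one>)}) = act (c x) \<beta>"
    by metis
  have f_class: "f (\<sigma> `` {(x, s)}) = act (s \<otimes> c x) \<beta>" if x: "x \<in> X" and s: "s \<in> carrier S" for x s
  proof -
    have "\<sigma> `` {(x, s)} = quotient_act (free_act S) \<sigma> s (\<sigma> `` {(x, \<one>)})"
      using quotient_act_class[OF \<sigma> s in_free[OF x one_closed]] s by (simp add: free_act_def)
    then have "f (\<sigma> `` {(x, s)}) = act s (f (\<sigma> `` {(x, \<one>)}))"
      using f(2) s in_free[OF x one_closed] by (simp add: quotientI)
    then show ?thesis using x s \<beta> by (simp add: c act_mult)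
  qed
  have \<sigma>_iff: "((x, s), (y, t)) \<in> \<sigma> \<longleftrightarrow> act (s \<otimes> c x) \<beta> = act (t \<otimes> c y) \<beta>"
    if "x \<in> X" "y \<in> X" "s \<in> carrier S" "t \<in> carrier S" for x y s t
  proof -
    have "((x, s), (y, t)) \<in> \<sigma> \<longleftrightarrow> \<sigma> `` {(x, s)} = \<sigma> `` {(y, t)}"
      using eq_equiv_class_iff[OF eq\<sigma>] in_free that by blast
    also have "\<dots> \<longleftrightarrow> f (\<sigma> `` {(x, s)}) = f (\<sigma> `` {(y, t)})"
      using bij_betw_imp_inj_on[OF f(1)] in_free that
      by (subst inj_on_eq_iff[of f]) (auto intro: quotientI)
    finally show ?thesis using that by (simp add: f_class)
  qed
  have "\<beta> \<in> B" unfolding B using act_one[OF \<beta>] by force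
  then obtain C where C: "C \<in> free_act_carrier X S // \<sigma>" "f C = \<beta>"
    using f(1) by (metis bij_betw_imp_surj_on imageE)
  obtain x0 d where d: "x0 \<in> X" "d \<in> carrier S" "C = \<sigma> `` {(x0, d)}"
    using C(1) by (elim quotientE) (auto simp: free_act_carrier_def)
  have dc: "act (d \<otimes> c x0) \<beta> = \<beta>" using f_class[OF d(1,2)] C(2) d(3) by simp

  \<comment> \<open>The pull-back of \<open>K i\<close> along the map that sends the generator \<open>x\<close> to \<open>c x\<close>.\<close>
  define \<tau> where "\<tau> i = {((x, s), (y, t)). x \<in> X \<and> y \<in> X \<and> s \<in> carrier S \<and> t \<in> carrier S \<and>
      (s \<otimes> c x, t \<otimes> c y) \<in> K i}" for i
  have eqK: "equiv (carrier S) (K i)" for i using K by (simp add: act_congruence_def)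
  have K_mult: "(r \<otimes> s, r \<otimes> t) \<in> K i" if "(s, t) \<in> K i" "r \<in> carrier S" for r s t i
    using K[of i] that unfolding act_congruence_def by blast
  have \<tau>: "act_congruence S (free_act_carrier X S) (free_act S) (\<tau> i)" for i
    unfolding act_congruence_def
  proof (intro conjI equivI)
    show "\<tau> i \<subseteq> free_act_carrier X S \<times> free_act_carrier X S"
      by (auto simp: \<tau>_def free_act_carrier_def)
    show "refl_on (free_act_carrier X S) (\<tau> i)"
      using eqK[of i] c(1)
      by (auto simp: \<tau>_def free_act_carrier_def refl_on_def equiv_def)
    show "sym (\<tau> i)" using eqK[of i] by (auto simp: \<tau>_def equiv_def sym_def)
    show "trans (\<tau> i)" using eqK[of i] unfolding \<tau>_def equiv_def trans_def by blast
    show "\<forall>r\<in>carrier S. \<forall>(p, q)\<in>\<tau> i. (free_act S r p, free_act S r q) \<in> \<tau> i"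
      using K_mult c(1) by (auto simp: \<tau>_def free_act_def m_assoc)
  qed
  have "eventually (\<lambda>i. p \<in> \<tau> i) \<F>" if pH: "p \<in> H" for p
  proof -
    obtain x s y t where p: "p = ((x, s), (y, t))" "x \<in> X" "y \<in> X" "s \<in> carrier S" "t \<in> carrier S"
      using subsetD[OF H(2) pH] by (auto simp: free_act_carrier_def)
    have "p \<in> \<sigma>" using pH generated_congruence_generators unfolding H(3) by blast
    then have "act (s \<otimes> c x) \<beta> = act (t \<otimes> c y) \<beta>" using p \<sigma>_iff by simp
    then show ?thesis
      using ev[of "s \<otimes> c x" "t \<otimes> c y"] p c(1) by (simp add: \<tau>_def)
  qed
  then have "eventually (\<lambda>i. \<forall>p\<in>H. p \<in> \<tau> i) \<F>"
    using H(1) by (simp add: eventually_ball_finite)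
  moreover have "eventually (\<lambda>i. (d \<otimes> c x0, \<one>) \<in> K i) \<F>"
    using d(1,2) dc c(1) by (intro ev) (simp_all add: act_one \<beta>)
  ultimately show ?thesis
  proof eventually_elim
    case (elim i)
    have "\<sigma> \<subseteq> \<tau> i"
      unfolding H(3) using elim(1) by (intro generated_congruence_least[OF \<tau>]) blast
    \<comment> \<open>Since \<open>d x0\<close> corresponds to \<open>\<beta>\<close>, the pair \<open>(s, t)\<close> is reached along
      \<open>s \<sim> s d (c x0) \<sim> t d (c x0) \<sim> t\<close>.\<close>
    show ?case
    proof (intro ballI impI)
      fix s t assume st: "s \<in> carrier S" "t \<in> carrier S" "act s \<beta> = act t \<beta>"
      have absorb: "act (r \<otimes> d \<otimes> c x0) \<beta> = act r \<beta>" "(r \<otimes> d \<otimes> c x0, r) \<in> K i"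
        if r: "r \<in> carrier S" for r
        using act_mult[of r "d \<otimes> c x0" \<beta>] K_mult[OF elim(2) r] r d(1,2) dc c(1)[OF d(1)] \<beta>
        by (simp_all add: m_assoc)
      have "((x0, s \<otimes> d), (x0, t \<otimes> d)) \<in> \<sigma>"
        using st d(1,2) absorb(1) by (simp add: \<sigma>_iff)
      then have "(s \<otimes> d \<otimes> c x0, t \<otimes> d \<otimes> c x0) \<in> K i"
        using \<open>\<sigma> \<subseteq> \<tau> i\<close> by (auto simp: \<tau>_def)
      then show "(s, t) \<in> K i"
        using absorb(2) st(1,2) eqK[of i] unfolding equiv_def by (meson symD transD)
    qed
  qed
qed

section \<open>A criterion for non-coherency\<close>

context monoid
begin

lemma mult_pow_shift:
  assumes "x \<in> carrier G" "y \<in> carrier G" "a \<in> carrier G" "x \<otimes> a [^] (m :: nat) = y \<otimes> a [^] (n :: nat)"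
  shows "x \<otimes> a [^] (m + k) = y \<otimes> a [^] (n + k)"
  using assms by (metis m_assoc nat_pow_closed nat_pow_mult)

text \<open>
  Identifying \<open>1\<close> with \<open>a\<close> identifies \<open>x\<close> with \<open>x a\<^sup>m\<close>, and nothing more is forced: by
  \<open>mult_pow_shift\<close> both exponents of an equation can be raised together, so two equations that
  share the middle element combine into one.
\<close>

lemma generated_congruence_one_pow_iff:
  fixes i :: 'i
  assumes a: "a \<in> carrier G" and x: "x \<in> carrier G" and y: "y \<in> carrier G"
  defines "\<rho> \<equiv> generated_congruence G (free_act_carrier {i} G) (free_act G) {((i, \<one>), (i, a))}"
  shows "((i, x), (i, y)) \<in> \<rho> \<longleftrightarrow> (\<exists>(m :: nat) (n :: nat). x \<otimes> a [^] m = y \<otimes> a [^] n)"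
proof
  define \<kappa> where "\<kappa> = {((i, x), (i, y)) | x y. x \<in> carrier G \<and> y \<in> carrier G \<and>
      (\<exists>(m :: nat) (n :: nat). x \<otimes> a [^] m = y \<otimes> a [^] n)}"
  have \<kappa>I: "((i, x), (i, y)) \<in> \<kappa>"
    if "x \<in> carrier G" "y \<in> carrier G" "x \<otimes> a [^] m = y \<otimes> a [^] n" for x y and m n :: nat
    using that by (simp add: \<kappa>_def) blast
  have "act_congruence G (free_act_carrier {i} G) (free_act G) \<kappa>"
    unfolding act_congruence_def
  proof (intro conjI equivI)
    show "\<kappa> \<subseteq> free_act_carrier {i} G \<times> free_act_carrier {i} G"
      by (auto simp: \<kappa>_def free_act_carrier_def)
    show "refl_on (free_act_carrier {i} G) \<kappa>"
    proof (rule refl_onI)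
      fix p assume "p \<in> free_act_carrier {i} G"
      then obtain x where "p = (i, x)" "x \<in> carrier G" by (auto simp: free_act_carrier_def)
      then show "(p, p) \<in> \<kappa>" using \<kappa>I[of x x 0 0] by simp
    qed
    show "sym \<kappa>"
    proof (rule symI)
      fix p q assume "(p, q) \<in> \<kappa>"
      then obtain x y and m n :: nat where "p = (i, x)" "q = (i, y)" "x \<in> carrier G" "y \<in> carrier G"
          "x \<otimes> a [^] m = y \<otimes> a [^] n"
        unfolding \<kappa>_def by blast
      then show "(q, p) \<in> \<kappa>" using \<kappa>I[of y x n m] by simp
    qed
    show "trans \<kappa>"
    proof (rule transI)
      fix p q r assume "(p, q) \<in> \<kappa>" "(q, r) \<in> \<kappa>"
      then obtain x y z and k l m n :: nat where eqs: "p = (i, x)" "q = (i, y)" "r = (i, z)"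
          "x \<in> carrier G" "y \<in> carrier G" "z \<in> carrier G"
          "x \<otimes> a [^] k = y \<otimes> a [^] l" "y \<otimes> a [^] m = z \<otimes> a [^] n"
        unfolding \<kappa>_def by blast
      have "x \<otimes> a [^] (k + m) = z \<otimes> a [^] (n + l)"
        using mult_pow_shift[of x y a k l m] mult_pow_shift[of y z a m n l] eqs a
        by (simp add: add.commute)
      then show "(p, r) \<in> \<kappa>" using eqs \<kappa>I by simp
    qed
    show "\<forall>s\<in>carrier G. \<forall>(p, q)\<in>\<kappa>. (free_act G s p, free_act G s q) \<in> \<kappa>"
    proof (intro ballI, clarify)
      fix s j x k y assume s: "s \<in> carrier G" and "((j, x), (k, y)) \<in> \<kappa>"
      then obtain m n :: nat where eqs: "j = i" "k = i" "x \<in> carrier G" "y \<in> carrier G"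
          "x \<otimes> a [^] m = y \<otimes> a [^] n"
        unfolding \<kappa>_def by blast
      then have "s \<otimes> x \<otimes> a [^] m = s \<otimes> y \<otimes> a [^] n" using s a by (simp add: m_assoc)
      then show "(free_act G s (j, x), free_act G s (k, y)) \<in> \<kappa>"
        using s eqs(1-4) \<kappa>I by (simp add: free_act_def)
    qed
  qed
  moreover have "((i, \<one>), (i, a)) \<in> \<kappa>"
  proof -
    have "\<one> \<otimes> a [^] (1 :: nat) = a \<otimes> a [^] (0 :: nat)" using a by simp
    then show ?thesis using a \<kappa>I by blast
  qed
  ultimately have "\<rho> \<subseteq> \<kappa>" unfolding \<rho>_def by (simp add: generated_congruence_least)
  moreover assume "((i, x), (i, y)) \<in> \<rho>"
  ultimately show "\<exists>(m :: nat) (n :: nat). x \<otimes> a [^] m = y \<otimes> a [^] n" unfolding \<kappa>_def by blast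
next
  interpret free: left_act G "free_act_carrier {i} G" "free_act G"
    by (rule left_act_free[OF monoid_axioms])
  have "act_congruence G (free_act_carrier {i} G) (free_act G) \<rho>"
    unfolding \<rho>_def using a
    by (intro act_congruence_generated free.act_closed) (auto simp: free_act_carrier_def)
  then have eq: "equiv (free_act_carrier {i} G) \<rho>"
    and cong: "\<And>s p q. \<lbrakk>s \<in> carrier G; (p, q) \<in> \<rho>\<rbrakk> \<Longrightarrow> (free_act G s p, free_act G s q) \<in> \<rho>"
    unfolding act_congruence_def by auto
  have gen: "((i, \<one>), (i, a)) \<in> \<rho>"
    unfolding \<rho>_def using generated_congruence_generators by blast
  have pow: "((i, z), (i, z \<otimes> a [^] m)) \<in> \<rho>" if z: "z \<in> carrier G" for z and m :: nat
  proof (induction m)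
    case 0
    show ?case using eq z by (auto simp: equiv_def refl_on_def free_act_carrier_def)
  next
    case (Suc m)
    have "((i, z \<otimes> a [^] m), (i, z \<otimes> a [^] Suc m)) \<in> \<rho>"
      using cong[OF _ gen, of "z \<otimes> a [^] m"] z a by (simp add: free_act_def m_assoc)
    with Suc show ?case using eq by (auto simp: equiv_def dest: transD)
  qed
  assume "\<exists>(m :: nat) (n :: nat). x \<otimes> a [^] m = y \<otimes> a [^] n"
  then show "((i, x), (i, y)) \<in> \<rho>"
    using pow[OF x] pow[OF y] eq unfolding equiv_def by (metis symD transD)
qed

text \<open>
  The invariant for chains of generating pairs, used with \<open>v = b a\<^sup>N\<close>: as long as an element of
  the chain fixes \<open>v a\<close>, its product with \<open>v\<close> cannot change. The quantifier over \<open>r\<close> makes the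
  relation compatible with the left action, and the disjunction makes it symmetric. It is
  transitive because multiples that agree on \<open>v\<close> also agree on \<open>v a\<close>.
\<close>

definition fixing_congruence :: "'a \<Rightarrow> 'a \<Rightarrow> 'a rel"
  where "fixing_congruence v a = {(s, t). s \<in> carrier G \<and> t \<in> carrier G \<and>
    (\<forall>r\<in>carrier G. r \<otimes> s \<otimes> (v \<otimes> a) = v \<otimes> a \<or> r \<otimes> t \<otimes> (v \<otimes> a) = v \<otimes> a \<longrightarrow>
       r \<otimes> s \<otimes> v = r \<otimes> t \<otimes> v)}"

lemma act_congruence_fixing_congruence:
  assumes v: "v \<in> carrier G" and a: "a \<in> carrier G"
  shows "act_congruence G (carrier G) (mult G) (fixing_congruence v a)"
  unfolding act_congruence_def
proof (intro conjI equivI)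
  show "fixing_congruence v a \<subseteq> carrier G \<times> carrier G"
    by (auto simp: fixing_congruence_def)
  show "refl_on (carrier G) (fixing_congruence v a)"
    by (auto simp: fixing_congruence_def refl_on_def)
  show "sym (fixing_congruence v a)"
    by (auto simp: fixing_congruence_def sym_def)
  show "trans (fixing_congruence v a)"
  proof (rule transI)
    fix x y z assume xy: "(x, y) \<in> fixing_congruence v a" and yz: "(y, z) \<in> fixing_congruence v a"
    have cl: "x \<in> carrier G" "y \<in> carrier G" "z \<in> carrier G"
      using xy yz by (auto simp: fixing_congruence_def)
    have "r \<otimes> x \<otimes> v = r \<otimes> z \<otimes> v"
      if r: "r \<in> carrier G" and fixed: "r \<otimes> x \<otimes> (v \<otimes> a) = v \<otimes> a \<or> r \<otimes> z \<otimes> (v \<otimes> a) = v \<otimes> a" for r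
    proof -
      have "r \<otimes> y \<otimes> (v \<otimes> a) = v \<otimes> a"
      proof -
        have assoc: "r \<otimes> w \<otimes> (v \<otimes> a) = r \<otimes> w \<otimes> v \<otimes> a" if "w \<in> carrier G" for w
          using that r v a by (simp add: m_assoc)
        from fixed show ?thesis
        proof
          assume *: "r \<otimes> x \<otimes> (v \<otimes> a) = v \<otimes> a"
          then have "r \<otimes> x \<otimes> v = r \<otimes> y \<otimes> v"
            using xy r unfolding fixing_congruence_def by blast
          then show ?thesis using * assoc cl by metis
        next
          assume *: "r \<otimes> z \<otimes> (v \<otimes> a) = v \<otimes> a"
          then have "r \<otimes> y \<otimes> v = r \<otimes> z \<otimes> v"
            using yz r unfolding fixing_congruence_def by blast
          then show ?thesis using * assoc cl by metis
        qed
      qed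
      then have "r \<otimes> x \<otimes> v = r \<otimes> y \<otimes> v" "r \<otimes> y \<otimes> v = r \<otimes> z \<otimes> v"
        using xy yz r unfolding fixing_congruence_def by blast+
      then show ?thesis by simp
    qed
    then show "(x, z) \<in> fixing_congruence v a"
      using cl unfolding fixing_congruence_def by blast
  qed
  show "\<forall>s\<in>carrier G. \<forall>(x, y)\<in>fixing_congruence v a. (s \<otimes> x, s \<otimes> y) \<in> fixing_congruence v a"
  proof (clarify)
    fix s x y assume s: "s \<in> carrier G" and xy: "(x, y) \<in> fixing_congruence v a"
    have "r \<otimes> (s \<otimes> x) = r \<otimes> s \<otimes> x" "r \<otimes> (s \<otimes> y) = r \<otimes> s \<otimes> y" if "r \<in> carrier G" for r
      using that s xy by (auto simp: fixing_congruence_def m_assoc)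
    then show "(s \<otimes> x, s \<otimes> y) \<in> fixing_congruence v a"
      using s xy by (auto simp: fixing_congruence_def)
  qed
qed

text \<open>
  This is where the exponents are forced to agree: if \<open>r s\<close> fixes \<open>b a\<^bsup>N+1\<^esup>\<close>, then \<open>b a\<^bsup>N+1\<^esup>\<close> is a
  left multiple of \<open>b a\<^bsup>N+1-m+n\<^esup>\<close>, so \<open>m = n\<close>.
\<close>

lemma mem_fixing_congruence:
  fixes m n N :: nat
  assumes ab: "a \<in> carrier G" "b \<in> carrier G" and st: "s \<in> carrier G" "t \<in> carrier G"
    and incomparable: "\<And>i j :: nat. \<And>z. \<lbrakk>z \<in> carrier G; b \<otimes> a [^] i = z \<otimes> (b \<otimes> a [^] j)\<rbrakk> \<Longrightarrow> i = j"
    and eq: "s \<otimes> b \<otimes> a [^] m = t \<otimes> b \<otimes> a [^] n" and N: "m \<le> N" "n \<le> N"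
  shows "(s, t) \<in> fixing_congruence (b \<otimes> a [^] N) a"
proof -
  have exponents: "m' = n'"
    if fixed: "r \<otimes> s' \<otimes> (b \<otimes> a [^] N \<otimes> a) = b \<otimes> a [^] N \<otimes> a"
      and eq': "s' \<otimes> b \<otimes> a [^] m' = t' \<otimes> b \<otimes> a [^] n'" and "m' \<le> N"
      and cl: "r \<in> carrier G" "s' \<in> carrier G" "t' \<in> carrier G" for r s' t' and m' n' :: nat
  proof -
    define k where "k = Suc N - m'"
    have k: "Suc N = m' + k" using \<open>m' \<le> N\<close> unfolding k_def by simp
    have "b \<otimes> a [^] Suc N = r \<otimes> (s' \<otimes> b \<otimes> a [^] (m' + k))"
      using fixed cl ab unfolding k[symmetric] by (simp add: m_assoc)
    also have "s' \<otimes> b \<otimes> a [^] (m' + k) = t' \<otimes> b \<otimes> a [^] (n' + k)"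
      using eq' cl ab by (intro mult_pow_shift) auto
    finally have "b \<otimes> a [^] Suc N = r \<otimes> t' \<otimes> (b \<otimes> a [^] (n' + k))"
      using cl ab by (simp add: m_assoc)
    then have "Suc N = n' + k" using cl by (intro incomparable) auto
    then show ?thesis using k by simp
  qed
  have agree: "r \<otimes> s \<otimes> (b \<otimes> a [^] N) = r \<otimes> t \<otimes> (b \<otimes> a [^] N)" if "m = n" "r \<in> carrier G" for r
  proof -
    have "s \<otimes> b \<otimes> a [^] (m + (N - m)) = t \<otimes> b \<otimes> a [^] (n + (N - m))"
      using eq st ab by (intro mult_pow_shift) auto
    then show ?thesis using that N st ab by (simp add: m_assoc)
  qed
  show ?thesis
    unfolding fixing_congruence_def
    using st agree exponents[OF _ eq N(1)] exponents[OF _ eq[symmetric] N(2)] by fastforce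
qed

text \<open>
  The subact generated by \<open>b\<close> in the act obtained by identifying \<open>1\<close> with \<open>a\<close> is finitely
  generated but not finitely presented: the pairs \<open>(f, 1)\<close>, with \<open>f\<close> separating \<open>b a\<^bsup>N+1\<^esup>\<close> from
  \<open>b a\<^sup>N\<close>, belong to the annihilator of \<open>b\<close> and escape each of the congruences
  \<open>fixing_congruence (b a\<^sup>N) a\<close> in turn.
\<close>

lemma not_left_coherent_if_fixing_separated:
  assumes ab: "a \<in> carrier G" "b \<in> carrier G"
    and incomparable: "\<And>i j :: nat. \<And>z. \<lbrakk>z \<in> carrier G; b \<otimes> a [^] i = z \<otimes> (b \<otimes> a [^] j)\<rbrakk> \<Longrightarrow> i = j"
    and separated: "\<And>i :: nat. \<exists>f\<in>carrier G.
      f \<otimes> (b \<otimes> a [^] (i + 1)) = b \<otimes> a [^] (i + 1) \<and> f \<otimes> (b \<otimes> a [^] i) \<noteq> b \<otimes> a [^] i"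
  shows "\<not> left_coherent G"
proof
  assume coherent: "left_coherent G"
  let ?Fr = "free_act_carrier {0 :: nat} G"
  define \<rho> where "\<rho> = generated_congruence G ?Fr (free_act G) {((0, \<one>), (0, a))}"
  let ?q = "quotient_act (free_act G) \<rho>"
  interpret free: left_act G ?Fr "free_act G"
    by (rule left_act_free[OF monoid_axioms])
  have gens: "{((0, \<one>), (0, a))} \<subseteq> ?Fr \<times> ?Fr"
    using ab by (simp add: free_act_carrier_def)
  have \<rho>: "act_congruence G ?Fr (free_act G) \<rho>"
    unfolding \<rho>_def using free.act_closed gens by (rule act_congruence_generated)
  interpret Q: left_act G "?Fr // \<rho>" ?q
    using \<rho> by (rule free.left_act_quotient)
  define \<beta> where "\<beta> = \<rho> `` {(0, b)}"
  define B where "B = {?q s \<beta> | s. s \<in> carrier G}"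
  have b0: "(0, b) \<in> ?Fr" using ab by (simp add: free_act_carrier_def)
  then have \<beta>: "\<beta> \<in> ?Fr // \<rho>" unfolding \<beta>_def by (rule quotientI)
  have "isomorphic_acts G (?Fr // \<rho>) ?q (?Fr // \<rho>) ?q"
    unfolding isomorphic_acts_def by (intro exI[of _ id]) auto
  then have "finitely_presented_act G (?Fr // \<rho>) ?q"
    unfolding finitely_presented_act_def finitely_generated_congruence_def
    using gens \<rho>_def by (intro exI[of _ "{0 :: nat}"] exI[of _ \<rho>]) blast
  moreover have "finitely_generated_subact G (?Fr // \<rho>) ?q B"
    unfolding finitely_generated_subact_def B_def using \<beta> by (intro exI[of _ "{\<beta>}"]) auto
  ultimately have fp: "finitely_presented_act G B ?q"
    using coherent Q.left_act_axioms by (blast intro: left_coherentD)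
  have annihilator: "?q s \<beta> = ?q t \<beta> \<longleftrightarrow> (\<exists>(m :: nat) (n :: nat). s \<otimes> b \<otimes> a [^] m = t \<otimes> b \<otimes> a [^] n)"
    if "s \<in> carrier G" "t \<in> carrier G" for s t
  proof -
    have "?q s \<beta> = ?q t \<beta> \<longleftrightarrow> \<rho> `` {(0, s \<otimes> b)} = \<rho> `` {(0, t \<otimes> b)}"
      unfolding \<beta>_def using that b0 by (simp add: quotient_act_class[OF \<rho>] free_act_def)
    also have "\<dots> \<longleftrightarrow> ((0, s \<otimes> b), (0, t \<otimes> b)) \<in> \<rho>"
      using \<rho> that ab unfolding act_congruence_def
      by (intro eq_equiv_class_iff) (auto simp: free_act_carrier_def)
    finally show ?thesis
      unfolding \<rho>_def using that ab by (simp add: generated_congruence_one_pow_iff)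
  qed
  define K where "K N = fixing_congruence (b \<otimes> a [^] (N :: nat)) a" for N
  have "eventually (\<lambda>N. \<forall>s\<in>carrier G. \<forall>t\<in>carrier G. ?q s \<beta> = ?q t \<beta> \<longrightarrow> (s, t) \<in> K N) sequentially"
  proof (rule Q.annihilator_compact[OF \<beta> B_def fp])
    show "act_congruence G (carrier G) (mult G) (K N)" for N
      unfolding K_def using ab by (intro act_congruence_fixing_congruence) auto
  next
    fix s t assume st: "s \<in> carrier G" "t \<in> carrier G" "?q s \<beta> = ?q t \<beta>"
    then obtain m n :: nat where eq: "s \<otimes> b \<otimes> a [^] m = t \<otimes> b \<otimes> a [^] n"
      using annihilator by blast
    show "eventually (\<lambda>N. (s, t) \<in> K N) sequentially"
      unfolding K_def using eventually_ge_at_top[of "max m n"]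
      by eventually_elim (rule mem_fixing_congruence[OF ab st(1,2) incomparable eq]; simp)
  qed
  then obtain N where N:
      "\<And>s t. \<lbrakk>s \<in> carrier G; t \<in> carrier G; ?q s \<beta> = ?q t \<beta>\<rbrakk> \<Longrightarrow> (s, t) \<in> K N"
    unfolding eventually_sequentially by blast
  obtain f where f: "f \<in> carrier G" "f \<otimes> (b \<otimes> a [^] (N + 1)) = b \<otimes> a [^] (N + 1)"
      "f \<otimes> (b \<otimes> a [^] N) \<noteq> b \<otimes> a [^] N"
    using separated by blast
  have "f \<otimes> b \<otimes> a [^] (N + 1) = \<one> \<otimes> b \<otimes> a [^] (N + 1)"
    using f(1,2) ab by (simp add: m_assoc)
  then have "?q f \<beta> = ?q \<one> \<beta>" using annihilator[of f \<one>] f(1) by blast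
  then have "(f, \<one>) \<in> K N" using f(1) by (intro N) auto
  \<comment> \<open>The multiplier \<open>\<one>\<close> already shows that \<open>f\<close> fixes \<open>b a\<^sup>N\<close>.\<close>
  moreover have "\<one> \<otimes> f \<otimes> (b \<otimes> a [^] N \<otimes> a) = b \<otimes> a [^] N \<otimes> a"
    using f(1,2) ab by (simp add: m_assoc)
  ultimately have "\<one> \<otimes> f \<otimes> (b \<otimes> a [^] N) = \<one> \<otimes> \<one> \<otimes> (b \<otimes> a [^] N)"
    unfolding K_def fixing_congruence_def by blast
  then show False using f(1,3) ab by simp
qed

end

section \<open>Submonoids of right Ehresmann monoids\<close>

lemma (in right_Ehresmann_monoid) L_le_left_multiple:
  assumes "z \<in> carrier S" "x \<in> carrier S"
  shows "L_le S E (z \<otimes> x) x"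
  using assms E_subset by (auto simp: L_le_def m_assoc)

text \<open>
  The powers of \<open>a\<close> in \<open>M\<close> and in \<open>F\<close> differ for exponent \<open>0\<close> when the two monoids have different
  identities, but the products \<open>b a\<^sup>i\<close> are the same in both.
\<close>

lemma monoid_subsemigroup_mult_pow:
  fixes F :: "('a, 'm) monoid_scheme" (structure) and i :: nat
  assumes "monoid F" and M: "monoid_subsemigroup F M u" and ab: "a \<in> M" "b \<in> M"
  shows "b \<otimes> a [^]\<^bsub>F\<lparr>carrier := M, one := u\<rparr>\<^esub> i = b \<otimes> a [^] i"
proof -
  interpret monoid F by fact
  interpret S: monoid "F\<lparr>carrier := M, one := u\<rparr>"
    using M by (simp add: monoid_subsemigroup_def)
  have sub: "M \<subseteq> carrier F" using M by (simp add: monoid_subsemigroup_def)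
  show ?thesis
  proof (induction i)
    case 0
    show ?case using S.r_one ab(2) sub by auto
  next
    case (Suc i)
    have "a [^]\<^bsub>F\<lparr>carrier := M, one := u\<rparr>\<^esub> i \<in> M" using S.nat_pow_closed ab(1) by auto
    with Suc show ?case using ab sub by (simp add: m_assoc[symmetric] subsetD)
  qed
qed

theorem theorem4p3:
  fixes F :: "('a, 'm) monoid_scheme" (structure) and E M :: "'a set" and u :: 'a
  assumes F: "right_Ehresmann_monoid F E"
    and M: "monoid_subsemigroup F M u"
    and cond1: "\<exists>plus. (\<forall>t\<in>carrier F. plus t \<in> E) \<and>
          (\<forall>t\<in>M. \<forall>x\<in>M. \<forall>e. e = t \<otimes> x \<longrightarrow> e = e \<otimes> e \<longrightarrow> e \<in> E \<longrightarrow>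
             e = plus t \<otimes> E_star F E x)"
    and cond2: "\<And>t x y w. \<lbrakk>t \<in> M; x \<in> M; y \<in> M; w \<in> M; t \<otimes> x \<in> E; x \<otimes> w = y \<otimes> w\<rbrakk>
          \<Longrightarrow> t \<otimes> y \<in> E"
    and cond3: "\<exists>a\<in>M. \<exists>b\<in>M.
          (\<forall>i j :: nat. i \<noteq> j \<longrightarrow> \<not> L_le F E (b \<otimes> a [^] i) (b \<otimes> a [^] j)) \<and>
          (\<forall>i :: nat. M \<inter> (left_identities F E (b \<otimes> a [^] (i + 1)) -
                           left_identities F E (b \<otimes> a [^] i)) \<noteq> {}) \<and>
          (\<forall>i :: nat. \<forall>x\<in>M. \<forall>y\<in>M.
             x \<otimes> (b \<otimes> a [^] i) = y \<otimes> (b \<otimes> a [^] i) \<longrightarrow>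
             E_star F E x \<otimes> (b \<otimes> a [^] i) = b \<otimes> a [^] i \<longrightarrow>
             E_star F E y \<otimes> (b \<otimes> a [^] i) = b \<otimes> a [^] i)"
  shows "\<not> left_coherent (F\<lparr>carrier := M, one := u\<rparr>)"
proof -
  interpret right_Ehresmann_monoid F E by (fact F)
  let ?S = "F\<lparr>carrier := M, one := u\<rparr>"
  interpret S: monoid ?S using M by (simp add: monoid_subsemigroup_def)
  have sub: "M \<subseteq> carrier F" using M by (simp add: monoid_subsemigroup_def)
  obtain a b where ab: "a \<in> M" "b \<in> M"
    and incomparable: "\<And>i j :: nat. i \<noteq> j \<Longrightarrow> \<not> L_le F E (b \<otimes> a [^] i) (b \<otimes> a [^] j)"
    and separated: "\<And>i :: nat. M \<inter> (left_identities F E (b \<otimes> a [^] (i + 1)) -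
                           left_identities F E (b \<otimes> a [^] i)) \<noteq> {}"
    using cond3 by blast
  note pow = monoid_subsemigroup_mult_pow[OF monoid_axioms M ab]
  have in_F: "b \<otimes> a [^] i \<in> carrier F" for i :: nat using ab sub by auto
  show ?thesis
  proof (rule S.not_left_coherent_if_fixing_separated[of a b])
    show "a \<in> carrier ?S" "b \<in> carrier ?S" using ab by simp_all
  next
    fix i j :: nat and z
    assume "z \<in> carrier ?S"
      "b \<otimes>\<^bsub>?S\<^esub> a [^]\<^bsub>?S\<^esub> i = z \<otimes>\<^bsub>?S\<^esub> (b \<otimes>\<^bsub>?S\<^esub> a [^]\<^bsub>?S\<^esub> j)"
    then have "z \<in> carrier F" "b \<otimes> a [^] i = z \<otimes> (b \<otimes> a [^] j)"
      using sub by (auto simp: pow)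
    then have "L_le F E (b \<otimes> a [^] i) (b \<otimes> a [^] j)"
      using L_le_left_multiple in_F by metis
    then show "i = j" using incomparable by blast
  next
    fix i :: nat
    show "\<exists>f\<in>carrier ?S. f \<otimes>\<^bsub>?S\<^esub> (b \<otimes>\<^bsub>?S\<^esub> a [^]\<^bsub>?S\<^esub> (i + 1)) = b \<otimes>\<^bsub>?S\<^esub> a [^]\<^bsub>?S\<^esub> (i + 1) \<and>
        f \<otimes>\<^bsub>?S\<^esub> (b \<otimes>\<^bsub>?S\<^esub> a [^]\<^bsub>?S\<^esub> i) \<noteq> b \<otimes>\<^bsub>?S\<^esub> a [^]\<^bsub>?S\<^esub> i"
      using separated[of i] pow[of i] pow[of "i + 1"]
      by (auto simp: left_identities_def simp del: nat_pow_Suc S.nat_pow_Suc)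
  qed
qed

end
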